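(* Every finite Sugihara chain is finitely representable; that is, for every $n\geqslant 2$ the finite Sugihara chain $\mathbf S_n$, viewed as a distributive quasi relation algebra, is finitely representable.
   Context: Finite Sugihara chains viewed as DqRAs: for $n\geqslant2$, $\mathbf S_n=\langle S_n,\wedge,\vee,\cdot,{\sim},-,\neg,1,0\rangle$ where $S_n=\{a_{-k},\dots,a_{-1},a_1,\dots,a_k\}$ if $n=2k$ ($k>0$) and $S_n=\{a_{-k},\dots,a_{-1},a_0,a_1,\dots,a_k\}$ if $n=2k+1$ ($k>0$); $a_i\wedge a_j=a_{\min\{i,j\}}$, $a_i\vee a_j=a_{\max\{i,j\}}$; ${\sim}a_j=-a_j=\neg a_j=a_{-j}$; $a_i\cdot a_j=a_i$ if $|j|<|i|$, $a_j$ if $|i|<|j|$, and $a_{\min\{i,j\}}$ if $|i|=|j|$; $1=a_0$ if $n$ is odd and $1=a_1$ if $n$ is even; $0={\sim}1$. An InFL-algebra is an algebra $\langle A,\wedge,\vee,\cdot,{\sim},-,1,0\rangle$ with $0=-1={\sim}1$, where $\langle A,\wedge,\vee\rangle$ is a lattice, $\langle A,\cdot,1\rangle$ is a monoid and $a\cdot b\leqslant c\iff a\leqslant -(b\cdot{\sim}c)\iff b\leqslant {\sim}(-c\cdot a)$. A quasi relation algebra is an algebra $\langle A,\wedge,\vee,\cdot,{\sim},-,\neg,1,0\rangle$ whose $\neg$-free reduct is an InFL-algebra and which satisfies $\neg\neg a=a$, $\neg(a\vee b)=\neg a\wedge\neg b$, $\neg({\sim}a)=-(\neg a)$ and $\neg(a\cdot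 b)=\neg a+\neg b$, where $a+b={\sim}(-a\cdot-b)$. A DqRA is a quasi relation algebra with distributive lattice reduct. Representability: for binary relations, $R^\smile=\{(x,y)\mid (y,x)\in R\}$ and $R\mathbin{;}S=\{(x,y)\mid \exists z\,((x,z)\in R,\ (z,y)\in S)\}$; functions are identified with their graphs. Let $(X,\leqslant)$ be a poset, $E$ an equivalence relation on $X$ with ${\leqslant}\subseteq E$, and write $R^c=E\setminus R$ for $R\subseteq E$. Order $E$ by $(u,v)\preccurlyeq(x,y)$ iff $x\leqslant u$ and $v\leqslant y$; let $\mathbf E=(E,\preccurlyeq)$ and let $\mathsf{Up}(\mathbf E)$ be the set of its up-sets. Let $\alpha:X\to X$ be an order automorphism and $\beta:X\to X$ a self-inverse dual order automorphism with $\alpha,\beta\subseteq E$ and $\beta=\alpha\mathbin{;}\beta\mathbin{;}\alpha$. Then $\mathbf{Dq}(\mathbf E)=\langle\mathsf{Up}(\mathbf E),\cap,\cup,\mathbin{;},{\sim},-,\neg,1,0\rangle$ with $1={\leqslant}$, $0=\alpha\mathbin{;}({\leqslant}^c)^{\smile}$, ${\sim}R=(R^{c})^{\smile}\mathbin{;}\alpha$, $-R=\alpha\mathbin{;}(R^{c})^{\smile}$, $\neg R=\alpha\mathbin{;}\beta\mathbin{;}R^c\mathbin{;}\beta$ is a DqRA. A DqRA is representable if it is isomorphic to a subalgebra of some $\mathbf{Dq}(\mathbf E)$ (equivalently, to a subalgebra of a product of algebras $\mathbf{Dq}(\mathbf E)$ with $E=X^2$). It is finitely representable if the poset $(X,\leqslant)$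 used in the representation can be taken finite. *)

theory Defs
  imports "HOL-Algebra.Group"
begin

section \<open>Distributive quasi relation algebras\<close>

record 'a dq_algebra = "'a monoid" +
  dq_meet :: "'a \<Rightarrow> 'a \<Rightarrow> 'a" (infixl \<open>\<curlywedge>\<index>\<close> 70)
  dq_join :: "'a \<Rightarrow> 'a \<Rightarrow> 'a" (infixl \<open>\<curlyvee>\<index>\<close> 65)
  dq_tilde :: "'a \<Rightarrow> 'a" (\<open>\<sim>\<index> _\<close> [81] 80)
  dq_minus :: "'a \<Rightarrow> 'a" (\<open>\<ominus>\<index> _\<close> [81] 80)
  dq_neg :: "'a \<Rightarrow> 'a" (\<open>\<sharp>\<index> _\<close> [81] 80)
  dq_zero :: 'a (\<open>\<zero>\<index>\<close>)

definition dq_le :: "('a, 'm) dq_algebra_scheme \<Rightarrow> 'a \<Rightarrow> 'a \<Rightarrow> bool" (infix \<open>\<preceq>\<index>\<close> 50)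
  where "dq_le A a b \<longleftrightarrow> a \<curlywedge>\<^bsub>A\<^esub> b = a"

text \<open>
  The order of the two arguments inside the definition of \<open>a + b\<close> is immaterial
  for commutative algebras such as the Sugihara chains.
\<close>
definition dq_plus :: "('a, 'm) dq_algebra_scheme \<Rightarrow> 'a \<Rightarrow> 'a \<Rightarrow> 'a"
  where "dq_plus A a b = \<sim>\<^bsub>A\<^esub> (\<ominus>\<^bsub>A\<^esub> a \<otimes>\<^bsub>A\<^esub> \<ominus>\<^bsub>A\<^esub> b)"

locale InFL_algebra = monoid A for A (structure) +
  assumes meet_closed: "\<lbrakk>a \<in> carrier A; b \<in> carrier A\<rbrakk> \<Longrightarrow> a \<curlywedge> b \<in> carrier A"
    and join_closed: "\<lbrakk>a \<in> carrier A; b \<in> carrier A\<rbrakk> \<Longrightarrow> a \<curlyvee> b \<in> carrier A"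
    and tilde_closed: "a \<in> carrier A \<Longrightarrow> \<sim> a \<in> carrier A"
    and minus_closed: "a \<in> carrier A \<Longrightarrow> \<ominus> a \<in> carrier A"
    and meet_comm: "\<lbrakk>a \<in> carrier A; b \<in> carrier A\<rbrakk> \<Longrightarrow> a \<curlywedge> b = b \<curlywedge> a"
    and join_comm: "\<lbrakk>a \<in> carrier A; b \<in> carrier A\<rbrakk> \<Longrightarrow> a \<curlyvee> b = b \<curlyvee> a"
    and meet_assoc: "\<lbrakk>a \<in> carrier A; b \<in> carrier A; c \<in> carrier A\<rbrakk>
      \<Longrightarrow> (a \<curlywedge> b) \<curlywedge> c = a \<curlywedge> (b \<curlywedge> c)"
    and join_assoc: "\<lbrakk>a \<in> carrier A; b \<in> carrier A; c \<in> carrier A\<rbrakk>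
      \<Longrightarrow> (a \<curlyvee> b) \<curlyvee> c = a \<curlyvee> (b \<curlyvee> c)"
    and meet_absorb: "\<lbrakk>a \<in> carrier A; b \<in> carrier A\<rbrakk> \<Longrightarrow> a \<curlywedge> (a \<curlyvee> b) = a"
    and join_absorb: "\<lbrakk>a \<in> carrier A; b \<in> carrier A\<rbrakk> \<Longrightarrow> a \<curlyvee> (a \<curlywedge> b) = a"
    and zero_tilde: "\<zero> = \<sim> \<one>"
    and zero_minus: "\<zero> = \<ominus> \<one>"
    and residuation_left: "\<lbrakk>a \<in> carrier A; b \<in> carrier A; c \<in> carrier A\<rbrakk>
      \<Longrightarrow> a \<otimes> b \<preceq> c \<longleftrightarrow> a \<preceq> \<ominus> (b \<otimes> \<sim> c)"
    and residuation_right: "\<lbrakk>a \<in> carrier A; b \<in> carrier A; c \<in> carrier A\<rbrakk>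
      \<Longrightarrow> a \<otimes> b \<preceq> c \<longleftrightarrow> b \<preceq> \<sim> (\<ominus> c \<otimes> a)"

locale quasi_relation_algebra = InFL_algebra +
  assumes neg_closed: "a \<in> carrier A \<Longrightarrow> \<sharp> a \<in> carrier A"
    and neg_neg: "a \<in> carrier A \<Longrightarrow> \<sharp> (\<sharp> a) = a"
    and neg_join: "\<lbrakk>a \<in> carrier A; b \<in> carrier A\<rbrakk> \<Longrightarrow> \<sharp> (a \<curlyvee> b) = \<sharp> a \<curlywedge> \<sharp> b"
    and neg_tilde: "a \<in> carrier A \<Longrightarrow> \<sharp> (\<sim> a) = \<ominus> (\<sharp> a)"
    and neg_mult: "\<lbrakk>a \<in> carrier A; b \<in> carrier A\<rbrakk>
      \<Longrightarrow> \<sharp> (a \<otimes> b) = dq_plus A (\<sharp> a) (\<sharp> b)"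

locale DqRA = quasi_relation_algebra +
  assumes meet_join_distrib: "\<lbrakk>a \<in> carrier A; b \<in> carrier A; c \<in> carrier A\<rbrakk>
      \<Longrightarrow> a \<curlywedge> (b \<curlyvee> c) = (a \<curlywedge> b) \<curlyvee> (a \<curlywedge> c)"

definition dq_subuniverse :: "'a set \<Rightarrow> ('a, 'm) dq_algebra_scheme \<Rightarrow> bool"
  where "dq_subuniverse C A \<longleftrightarrow>
    C \<subseteq> carrier A \<and> \<one>\<^bsub>A\<^esub> \<in> C \<and> \<zero>\<^bsub>A\<^esub> \<in> C \<and>
    (\<forall>a\<in>C. \<forall>b\<in>C. a \<curlywedge>\<^bsub>A\<^esub> b \<in> C \<and> a \<curlyvee>\<^bsub>A\<^esub> b \<in> C \<and> a \<otimes>\<^bsub>A\<^esub> b \<in> C) \<and>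
    (\<forall>a\<in>C. \<sim>\<^bsub>A\<^esub> a \<in> C \<and> \<ominus>\<^bsub>A\<^esub> a \<in> C \<and> \<sharp>\<^bsub>A\<^esub> a \<in> C)"

definition dq_iso :: "('a, 'm) dq_algebra_scheme \<Rightarrow> ('b, 'n) dq_algebra_scheme \<Rightarrow> ('a \<Rightarrow> 'b) set"
  where "dq_iso A B = {h \<in> iso A B.
    h \<one>\<^bsub>A\<^esub> = \<one>\<^bsub>B\<^esub> \<and> h \<zero>\<^bsub>A\<^esub> = \<zero>\<^bsub>B\<^esub> \<and>
    (\<forall>a\<in>carrier A. \<forall>b\<in>carrier A.
       h (a \<curlywedge>\<^bsub>A\<^esub> b) = h a \<curlywedge>\<^bsub>B\<^esub> h b \<and> h (a \<curlyvee>\<^bsub>A\<^esub> b) = h a \<curlyvee>\<^bsub>B\<^esub> h b) \<and>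
    (\<forall>a\<in>carrier A.
       h (\<sim>\<^bsub>A\<^esub> a) = \<sim>\<^bsub>B\<^esub> (h a) \<and> h (\<ominus>\<^bsub>A\<^esub> a) = \<ominus>\<^bsub>B\<^esub> (h a) \<and> h (\<sharp>\<^bsub>A\<^esub> a) = \<sharp>\<^bsub>B\<^esub> (h a))}"


section \<open>Algebras of up-sets of an equivalence relation\<close>

text \<open>\<open>BNF_Def.Gr X f\<close> is the graph of \<open>f\<close> restricted to \<open>X\<close>; \<open>L\<close> is the partial order.\<close>

locale dq_frame =
  fixes X :: "'x set" and L E :: "'x rel" and \<alpha> \<beta> :: "'x \<Rightarrow> 'x"
  assumes poset: "partial_order_on X L"
    and equiv: "equiv X E"
    and L_E: "L \<subseteq> E"
    and \<alpha>_bij: "bij_betw \<alpha> X X"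
    and \<alpha>_order: "\<lbrakk>x \<in> X; y \<in> X\<rbrakk> \<Longrightarrow> (x, y) \<in> L \<longleftrightarrow> (\<alpha> x, \<alpha> y) \<in> L"
    and \<beta>_bij: "bij_betw \<beta> X X"
    and \<beta>_dual_order: "\<lbrakk>x \<in> X; y \<in> X\<rbrakk> \<Longrightarrow> (x, y) \<in> L \<longleftrightarrow> (\<beta> y, \<beta> x) \<in> L"
    and \<beta>_self_inverse: "x \<in> X \<Longrightarrow> \<beta> (\<beta> x) = x"
    and \<alpha>_E: "BNF_Def.Gr X \<alpha> \<subseteq> E"
    and \<beta>_E: "BNF_Def.Gr X \<beta> \<subseteq> E"
    and \<beta>_\<alpha>: "BNF_Def.Gr X \<beta> = BNF_Def.Gr X \<alpha> O BNF_Def.Gr X \<beta> O BNF_Def.Gr X \<alpha>"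

definition upsets :: "'x rel \<Rightarrow> 'x rel \<Rightarrow> 'x rel set"
  where "upsets L E = {R. R \<subseteq> E \<and>
    (\<forall>(u, v)\<in>R. \<forall>(x, y)\<in>E. (x, u) \<in> L \<and> (v, y) \<in> L \<longrightarrow> (x, y) \<in> R)}"

definition Dq :: "'x set \<Rightarrow> 'x rel \<Rightarrow> 'x rel \<Rightarrow> ('x \<Rightarrow> 'x) \<Rightarrow> ('x \<Rightarrow> 'x) \<Rightarrow> 'x rel dq_algebra"
  where "Dq X L E \<alpha> \<beta> = (let a = BNF_Def.Gr X \<alpha>; b = BNF_Def.Gr X \<beta> in
    \<lparr>carrier = upsets L E,
     mult = (\<lambda>R S. R O S),
     one = L,
     dq_meet = (\<lambda>R S. R \<inter> S),
     dq_join = (\<lambda>R S. R \<union> S),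
     dq_tilde = (\<lambda>R. (E - R)\<inverse> O a),
     dq_minus = (\<lambda>R. a O (E - R)\<inverse>),
     dq_neg = (\<lambda>R. a O b O (E - R) O b),
     dq_zero = a O (E - L)\<inverse>\<rparr>)"


section \<open>Finite representability\<close>

definition represented_over :: "('a, 'm) dq_algebra_scheme \<Rightarrow> 'x set \<Rightarrow> 'x rel \<Rightarrow> 'x rel
    \<Rightarrow> ('x \<Rightarrow> 'x) \<Rightarrow> ('x \<Rightarrow> 'x) \<Rightarrow> bool"
  where "represented_over A X L E \<alpha> \<beta> \<longleftrightarrow> dq_frame X L E \<alpha> \<beta> \<and>
    (\<exists>C. dq_subuniverse C (Dq X L E \<alpha> \<beta>) \<and>
         dq_iso A ((Dq X L E \<alpha> \<beta>)\<lparr>carrier := C\<rparr>) \<noteq> {})"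

text \<open>
  HOL cannot quantify over the type of points of \<open>X\<close>.  Taking them to be
  natural numbers loses nothing, since every finite frame is isomorphic to one
  whose points are natural numbers.
\<close>
definition finitely_representable :: "('a, 'm) dq_algebra_scheme \<Rightarrow> bool"
  where "finitely_representable A \<longleftrightarrow> DqRA A \<and>
    (\<exists>(X :: nat set) L E \<alpha> \<beta>. finite X \<and> represented_over A X L E \<alpha> \<beta>)"


section \<open>Finite Sugihara chains\<close>

text \<open>The element \<open>a\<^sub>j\<close> is encoded by its index \<open>j\<close>.\<close>

definition sugihara_chain :: "nat \<Rightarrow> int dq_algebra"
  where "sugihara_chain n =
    (let one = (if odd n then 0 else 1 :: int) in
    \<lparr>carrier = {j. \<bar>j\<bar> \<le> int (n div 2) \<and> (even n \<longrightarrow> j \<noteq> 0)},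
     mult = (\<lambda>i j. if \<bar>j\<bar> < \<bar>i\<bar> then i else if \<bar>i\<bar> < \<bar>j\<bar> then j else min i j),
     one = one,
     dq_meet = min,
     dq_join = max,
     dq_tilde = uminus,
     dq_minus = uminus,
     dq_neg = uminus,
     dq_zero = - one\<rparr>)"

end

theory Submission
  imports Defs
begin

text \<open>
  The chain is represented on an ordinal sum of layers of at most two points.  Write
  \<open>k = n div 2\<close>.  There is one layer for each integer \<open>l\<close> with \<open>\<bar>l\<bar> < k\<close>; points of
  a lower layer lie below all points of a higher one, and a layer is an antichain.  All layers
  have two points, except that layer \<open>0\<close> is a single point when \<open>n\<close> is even.  The
  automorphism \<open>\<alpha>\<close> swaps the two points of each layer, the dual automorphism \<open>\<beta>\<close>
  reflects the layers in layer \<open>0\<close>, and \<open>E\<close> is the full relation.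

  For \<open>j > 0\<close>, the element \<open>j\<close> becomes the preorder obtained from the order by
  collapsing the central block of layers \<open>\<bar>l\<bar> < j\<close> to a single class; \<open>- j\<close> becomes the
  order with all pairs inside that block deleted; \<open>0\<close> (for odd \<open>n\<close>) becomes the order
  itself.  These relations form a chain.  Up to a reversal of the pair and one application of
  \<open>\<alpha>\<close>, the operations \<open>\<sim>\<close>, \<open>-\<close> and \<open>\<not>\<close> are complementation, and complementation
  exchanges the two kinds of relation: two points of different layers are always comparable in
  exactly one direction, and within a two-point layer \<open>y\<close> equals \<open>x\<close> exactly when it differs
  from \<open>\<alpha> x\<close> (\<open>rel_uminus\<close>).

  The product is the heart of the matter (\<open>rel_mult\<close>).  A composition is never larger than the
  value in the chain, by inspection of the blocks.  Conversely, when \<open>\<bar>i\<bar> < \<bar>j\<bar>\<close> the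
  relation of \<open>i\<close> must not shrink the relation of \<open>j\<close>.  The only danger is a start point
  inside the irreflexive block of a negative \<open>i\<close>, and from there one can step out of the block
  to layer \<open>\<bar>i\<bar>\<close>, which still lies inside the block of \<open>j\<close>.  This is where a
  finite poset can imitate the density that idempotence of a strict order would require: outside
  its block the relation of \<open>- j\<close> is reflexive, because \<open>\<alpha>\<close> moves the points there.
\<close>

section \<open>Finite Sugihara chains are distributive quasi relation algebras\<close>

text \<open>
  The product of a chain extended to all integers.  Associativity and residuation hold for this
  extension, so they can be checked without reference to \<open>n\<close>; the parity of \<open>n\<close> enters
  only through the carrier and the unit.
\<close>
definition sugihara_mult :: "int \<Rightarrow> int \<Rightarrow> int" where
  "sugihara_mult i j = (if \<bar>j\<bar> < \<bar>i\<bar> then i else if \<bar>i\<bar> < \<bar>j\<bar> then j else min i j)"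

lemma sugihara_mult_assoc:
  "sugihara_mult (sugihara_mult i j) l = sugihara_mult i (sugihara_mult j l)"
  unfolding sugihara_mult_def by (smt (verit))

lemma sugihara_mult_residuation:
  "sugihara_mult i j \<le> l \<longleftrightarrow> i \<le> - sugihara_mult j (- l)"
  "sugihara_mult i j \<le> l \<longleftrightarrow> j \<le> - sugihara_mult (- l) i"
  unfolding sugihara_mult_def by (smt (verit))+

lemma sugihara_mult_cases: "sugihara_mult i j = i \<or> sugihara_mult i j = j"
  by (auto simp: sugihara_mult_def)

lemma sugihara_mult_unit:
  "sugihara_mult 0 j = j" "sugihara_mult j 0 = j"
  "j \<noteq> 0 \<Longrightarrow> sugihara_mult 1 j = j" "j \<noteq> 0 \<Longrightarrow> sugihara_mult j 1 = j"
  by (auto simp: sugihara_mult_def)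

lemma sugihara_chain_simps:
  "j \<in> carrier (sugihara_chain n) \<longleftrightarrow> \<bar>j\<bar> \<le> int (n div 2) \<and> (even n \<longrightarrow> j \<noteq> 0)"
  "\<one>\<^bsub>sugihara_chain n\<^esub> = (if odd n then 0 else 1)"
  "\<zero>\<^bsub>sugihara_chain n\<^esub> = - \<one>\<^bsub>sugihara_chain n\<^esub>"
  "i \<otimes>\<^bsub>sugihara_chain n\<^esub> j = sugihara_mult i j"
  "i \<curlywedge>\<^bsub>sugihara_chain n\<^esub> j = min i j"
  "i \<curlyvee>\<^bsub>sugihara_chain n\<^esub> j = max i j"
  "\<sim>\<^bsub>sugihara_chain n\<^esub> j = - j"
  "\<ominus>\<^bsub>sugihara_chain n\<^esub> j = - j"
  "\<sharp>\<^bsub>sugihara_chain n\<^esub> j = - j"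
  by (simp_all add: sugihara_chain_def sugihara_mult_def Let_def)

lemma DqRA_sugihara_chain:
  assumes "2 \<le> n"
  shows "DqRA (sugihara_chain n)"
proof -
  have le: "i \<preceq>\<^bsub>sugihara_chain n\<^esub> j \<longleftrightarrow> i \<le> j" for i j
    by (auto simp: dq_le_def sugihara_chain_simps)
  have mult: "sugihara_mult i j \<in> carrier (sugihara_chain n)"
    if "i \<in> carrier (sugihara_chain n)" "j \<in> carrier (sugihara_chain n)" for i j
    using sugihara_mult_cases[of i j] that by metis
  show ?thesis
  proof (unfold_locales, unfold le dq_plus_def sugihara_chain_simps(4-9))
    fix i j l :: int
    show "sugihara_mult i j \<le> l \<longleftrightarrow> i \<le> - sugihara_mult j (- l)"
      "sugihara_mult i j \<le> l \<longleftrightarrow> j \<le> - sugihara_mult (- l) i"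
      by (rule sugihara_mult_residuation)+
  qed (use assms mult in \<open>auto simp: sugihara_chain_simps sugihara_mult_unit
      sugihara_mult_assoc min_def max_def\<close>)
qed

section \<open>Layered posets\<close>

text \<open>
  \<open>h\<close> assigns to each point its layer.  The assumption \<open>\<alpha>_fixed_iff\<close> encodes the sizes
  of the layers: a layer is an orbit of \<open>\<alpha>\<close>, so it has two points unless it is the central
  layer and \<open>n\<close> is even.  In that exceptional case collapsing the central layer changes nothing,
  and this is how the unit \<open>1\<close> of an even chain comes to denote the order.
\<close>
locale layered_set =
  fixes n :: nat and X :: "'x set" and h :: "'x \<Rightarrow> int" and \<alpha> \<beta> :: "'x \<Rightarrow> 'x"
  assumes n_ge_2: "2 \<le> n"
    and \<alpha>_closed: "x \<in> X \<Longrightarrow> \<alpha> x \<in> X"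
    and \<beta>_closed: "x \<in> X \<Longrightarrow> \<beta> x \<in> X"
    and \<alpha>_\<alpha>: "x \<in> X \<Longrightarrow> \<alpha> (\<alpha> x) = x"
    and \<beta>_\<beta>: "x \<in> X \<Longrightarrow> \<beta> (\<beta> x) = x"
    and \<alpha>_\<beta>_commute: "x \<in> X \<Longrightarrow> \<alpha> (\<beta> x) = \<beta> (\<alpha> x)"
    and h_\<alpha>: "x \<in> X \<Longrightarrow> h (\<alpha> x) = h x"
    and h_\<beta>: "x \<in> X \<Longrightarrow> h (\<beta> x) = - h x"
    and layer: "\<lbrakk>x \<in> X; y \<in> X; h x = h y\<rbrakk> \<Longrightarrow> y = x \<or> y = \<alpha> x"
    and \<alpha>_fixed_iff: "x \<in> X \<Longrightarrow> \<alpha> x = x \<longleftrightarrow> even n \<and> h x = 0"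
    and layers: "h ` X = {l. \<bar>l\<bar> < int (n div 2)}"
begin

text \<open>
  One formula for the three kinds of relation: \<open>\<bar>j\<bar>\<close> is the size of the central block, and
  the sign of \<open>j\<close> tells whether the block is filled or emptied.
\<close>
definition rel :: "int \<Rightarrow> 'x rel"
  where "rel j = {(x, y) \<in> X \<times> X.
    if \<bar>h x\<bar> < \<bar>j\<bar> \<and> \<bar>h y\<bar> < \<bar>j\<bar> then 0 < j else h x < h y \<or> x = y}"

definition layer_order :: "'x rel"
  where "layer_order = {(x, y) \<in> X \<times> X. h x < h y \<or> x = y}"

abbreviation "S \<equiv> carrier (sugihara_chain n)"

lemma rel_iff:
  "(x, y) \<in> rel j \<longleftrightarrow> x \<in> X \<and> y \<in> X \<and>
    (if \<bar>h x\<bar> < \<bar>j\<bar> \<and> \<bar>h y\<bar> < \<bar>j\<bar> then 0 < j else h x < h y \<or> x = y)"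
  by (simp add: rel_def)

lemma S_iff: "j \<in> S \<longleftrightarrow> \<bar>j\<bar> \<le> int (n div 2) \<and> (even n \<longrightarrow> j \<noteq> 0)"
  by (simp add: sugihara_chain_simps)

lemma obtain_layer:
  assumes "\<bar>l\<bar> < int (n div 2)"
  obtains x where "x \<in> X" "h x = l"
  using assms layers by (metis (mono_tags, lifting) imageE mem_Collect_eq)

lemma rel_one: "rel \<one>\<^bsub>sugihara_chain n\<^esub> = layer_order"
proof -
  have "x = y" if "even n" "x \<in> X" "y \<in> X" "h x = 0" "h y = 0" for x y
    using layer[of x y] \<alpha>_fixed_iff[of x] that by auto
  then show ?thesis
    by (auto simp: rel_def layer_order_def sugihara_chain_simps split: if_splits)
qed

lemma rel_mono:
  assumes "i \<le> j"
  shows "rel i \<subseteq> rel j"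
  using assms by (auto simp: rel_iff split: if_splits)

lemma rel_subset_iff:
  assumes i: "i \<in> S" and j: "j \<in> S"
  shows "rel i \<subseteq> rel j \<longleftrightarrow> i \<le> j"
proof
  assume sub: "rel i \<subseteq> rel j"
  show "i \<le> j"
  proof (rule ccontr)
    assume "\<not> i \<le> j"
    then have less: "j < i" by simp
    show False
    proof (cases "\<bar>i\<bar> \<le> \<bar>j\<bar>")
      \<comment> \<open>A point on the rim of the larger block separates the relations: through a loop if
        that block is emptied by \<open>j\<close>, through the pair with its twin if it is filled by \<open>i\<close>.\<close>
      case True
      with less have "j < 0" by linarith
      with j have "\<bar>\<bar>j\<bar> - 1\<bar> < int (n div 2)" by (auto simp: S_iff)
      then obtain x where x: "x \<in> X" "h x = \<bar>j\<bar> - 1" by (rule obtain_layer)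
      have "(x, x) \<in> rel i" "(x, x) \<notin> rel j"
        using x less \<open>j < 0\<close> True by (auto simp: rel_iff)
      with sub show False by blast
    next
      case False
      with less have "0 < i" by linarith
      with i have "\<bar>i - 1\<bar> < int (n div 2)" by (auto simp: S_iff)
      then obtain x where x: "x \<in> X" "h x = i - 1" by (rule obtain_layer)
      have "\<alpha> x \<noteq> x"
        using \<alpha>_fixed_iff[of x] x False j by (auto simp: S_iff)
      then have "(x, \<alpha> x) \<in> rel i" "(x, \<alpha> x) \<notin> rel j"
        using x False \<open>0 < i\<close> by (auto simp: rel_iff \<alpha>_closed h_\<alpha>)
      with sub show False by blast
    qed
  qed
qed (rule rel_mono)

lemma rel_inj: "inj_on rel S"
  by (rule inj_onI) (metis antisym order_refl rel_subset_iff)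

lemma rel_min: "rel (min i j) = rel i \<inter> rel j"
  using rel_mono[of i j] rel_mono[of j i] by (auto simp: min_def)

lemma rel_max: "rel (max i j) = rel i \<union> rel j"
  using rel_mono[of i j] rel_mono[of j i] by (auto simp: max_def)

text \<open>
  Outside the central block, complementing \<open>h x < h y \<or> x = y\<close> and reversing the pair would
  leave the non-strict order of layers without its diagonal; the twist by \<open>\<alpha>\<close> trades the
  off-diagonal pairs of a layer for the diagonal ones.  A point fixed by \<open>\<alpha>\<close> would break this,
  but it lies in layer \<open>0\<close> of an even chain, hence in the block of every \<open>j \<in> S\<close>.
\<close>
lemma rel_uminus:
  assumes "j \<in> S"
  shows "rel (- j) = {(x, y) \<in> X \<times> X. (\<alpha> y, x) \<notin> rel j}"
proof -
  have "(x, y) \<in> rel (- j) \<longleftrightarrow> (\<alpha> y, x) \<notin> rel j" if X: "x \<in> X" "y \<in> X" for x y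
  proof -
    have "\<alpha> y \<noteq> x" if "x = y" "\<bar>j\<bar> \<le> \<bar>h x\<bar>"
      using \<alpha>_fixed_iff[of x] that X assms by (auto simp: S_iff)
    moreover have "\<alpha> y = x" if "x \<noteq> y" "h x = h y"
      using layer[of y x] that X by auto
    moreover have "h x < h y \<or> h x = h y \<or> h y < h x" by linarith
    moreover have "j \<noteq> 0" if "\<bar>h x\<bar> < \<bar>j\<bar>" using that by auto
    ultimately show ?thesis
      using X by (auto simp: rel_iff \<alpha>_closed h_\<alpha>)
  qed
  moreover have "rel (- j) \<subseteq> X \<times> X" by (auto simp: rel_iff)
  ultimately show ?thesis by blast
qed

lemma rel_\<beta>:
  assumes "x \<in> X" "y \<in> X"
  shows "(\<beta> x, \<beta> y) \<in> rel j \<longleftrightarrow> (y, x) \<in> rel j"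
proof -
  have "\<beta> x = \<beta> y \<longleftrightarrow> x = y" using assms \<beta>_\<beta> by metis
  with assms show ?thesis by (auto simp: rel_iff \<beta>_closed h_\<beta>)
qed

lemma rel_comp_subset:
  "rel i O rel j \<subseteq> rel (i \<otimes>\<^bsub>sugihara_chain n\<^esub> j)"
proof -
  have "(x, z) \<in> rel (sugihara_mult i j)"
    if "(x, y) \<in> rel i" "(y, z) \<in> rel j" for x y z
    using that unfolding rel_iff sugihara_mult_def by (smt (verit))
  then show ?thesis by (auto simp: sugihara_chain_simps)
qed

text \<open>
  If \<open>x\<close> has a loop in the relation of \<open>i\<close>, the loop serves as the first factor.  Otherwise
  \<open>x\<close> lies in the emptied block of \<open>i\<close>, and the first factor steps up to layer \<open>\<bar>i\<bar>\<close>,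
  the first one above that block.  It exists, and lies in the block of \<open>j\<close>, because
  \<open>\<bar>i\<bar> < \<bar>j\<bar>\<close>.
\<close>
lemma rel_subset_comp_less:
  assumes i: "i \<in> S" and j: "j \<in> S" and less: "\<bar>i\<bar> < \<bar>j\<bar>"
  shows "rel j \<subseteq> rel i O rel j"
proof
  fix p
  assume "p \<in> rel j"
  then obtain x y where p: "p = (x, y)" and xy: "(x, y) \<in> rel j" by (cases p) auto
  show "p \<in> rel i O rel j"
  proof (cases "(x, x) \<in> rel i")
    case True
    with xy show ?thesis by (auto simp: p)
  next
    case False
    with xy have x: "\<bar>h x\<bar> < \<bar>i\<bar>" "i \<le> 0" by (auto simp: rel_iff split: if_splits)
    have "\<bar>\<bar>i\<bar>\<bar> < int (n div 2)" using less j by (auto simp: S_iff)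
    then obtain z where z: "z \<in> X" "h z = \<bar>i\<bar>" by (rule obtain_layer)
    have "(x, z) \<in> rel i" "(z, y) \<in> rel j"
      using xy x z less by (auto simp: rel_iff split: if_splits)
    then show ?thesis by (auto simp: p)
  qed
qed

text \<open>The reflection \<open>\<beta>\<close> reverses every relation of the chain, hence also compositions.\<close>
lemma rel_subset_comp_greater:
  assumes i: "i \<in> S" and j: "j \<in> S" and less: "\<bar>j\<bar> < \<bar>i\<bar>"
  shows "rel i \<subseteq> rel i O rel j"
proof
  fix p
  assume "p \<in> rel i"
  then obtain x y where p: "p = (x, y)" and xy: "(x, y) \<in> rel i" by (cases p) auto
  then have X: "x \<in> X" "y \<in> X" by (auto simp: rel_iff)
  have "(\<beta> y, \<beta> x) \<in> rel j O rel i"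
    using rel_subset_comp_less[OF j i less] xy X by (auto simp: rel_\<beta>)
  then obtain z where z: "(\<beta> y, z) \<in> rel j" "(z, \<beta> x) \<in> rel i" by auto
  then have "z \<in> X" by (auto simp: rel_iff)
  then have "(x, \<beta> z) \<in> rel i" "(\<beta> z, y) \<in> rel j"
    using z X rel_\<beta>[of "\<beta> z" x i] rel_\<beta>[of y "\<beta> z" j] by (auto simp: \<beta>_closed \<beta>_\<beta>)
  then show "p \<in> rel i O rel j" by (auto simp: p)
qed

text \<open>
  A pair of the smaller relation lies in both, so it suffices that the first one has a loop
  at its start or the second one at its end.  A relation of nonnegative index has all loops.  If
  both indices are negative, at least one end of the pair lies outside the block, and both
  relations have a loop there.
\<close>
lemma rel_subset_comp_eq:
  assumes "\<bar>i\<bar> = \<bar>j\<bar>"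
  shows "rel (min i j) \<subseteq> rel i O rel j"
proof
  fix p
  assume "p \<in> rel (min i j)"
  then obtain x y where p: "p = (x, y)" and xy: "(x, y) \<in> rel (min i j)" by (cases p) auto
  then have both: "(x, y) \<in> rel i" "(x, y) \<in> rel j" by (auto simp: rel_min)
  have "(x, x) \<in> rel i \<or> (y, y) \<in> rel j"
    using xy assms by (auto simp: rel_iff split: if_splits)
  with both show "p \<in> rel i O rel j" by (auto simp: p)
qed

lemma rel_mult:
  assumes "i \<in> S" "j \<in> S"
  shows "rel (i \<otimes>\<^bsub>sugihara_chain n\<^esub> j) = rel i O rel j"
proof
  consider "\<bar>i\<bar> < \<bar>j\<bar>" | "\<bar>j\<bar> < \<bar>i\<bar>" | "\<bar>i\<bar> = \<bar>j\<bar>" by linarith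
  then show "rel (i \<otimes>\<^bsub>sugihara_chain n\<^esub> j) \<subseteq> rel i O rel j"
    using rel_subset_comp_less[OF assms] rel_subset_comp_greater[OF assms]
      rel_subset_comp_eq[of i j]
    by cases (simp_all add: sugihara_chain_simps sugihara_mult_def)
qed (rule rel_comp_subset)

lemma one_in_S: "\<one>\<^bsub>sugihara_chain n\<^esub> \<in> S"
  using n_ge_2 by (auto simp: sugihara_chain_simps)

text \<open>Up-closure says that composing with the order on both sides adds nothing; since the order
  is the image of the unit, this is an instance of multiplicativity.\<close>
lemma rel_upset:
  assumes "j \<in> S"
  shows "rel j \<in> upsets layer_order (X \<times> X)"
proof -
  interpret DqRA "sugihara_chain n" by (rule DqRA_sugihara_chain) (rule n_ge_2)
  have "layer_order O rel j = rel j" "rel j O layer_order = rel j"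
    using rel_mult[OF one_in_S assms] rel_mult[OF assms one_in_S] assms
    by (simp_all flip: rel_one)
  then have "layer_order O rel j O layer_order = rel j" by simp
  moreover have "rel j \<subseteq> X \<times> X" by (auto simp: rel_def)
  ultimately show ?thesis unfolding upsets_def by blast
qed

lemma dq_frame: "dq_frame X layer_order (X \<times> X) \<alpha> \<beta>"
proof
  show "partial_order_on X layer_order"
    by (auto simp: partial_order_on_def preorder_on_def refl_on_def layer_order_def
        intro!: transI antisymI)
  show "equiv X (X \<times> X)"
    by (auto simp: equiv_def refl_on_def intro!: symI transI)
  show "layer_order \<subseteq> X \<times> X" by (auto simp: layer_order_def)
  show "bij_betw \<alpha> X X"
    by (rule bij_betw_byWitness[where f' = \<alpha>]) (auto simp: \<alpha>_\<alpha> \<alpha>_closed)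
  show "bij_betw \<beta> X X"
    by (rule bij_betw_byWitness[where f' = \<beta>]) (auto simp: \<beta>_\<beta> \<beta>_closed)
  show "(x, y) \<in> layer_order \<longleftrightarrow> (\<alpha> x, \<alpha> y) \<in> layer_order" if "x \<in> X" "y \<in> X" for x y
    using that \<alpha>_\<alpha>[of x] \<alpha>_\<alpha>[of y] by (auto simp: layer_order_def \<alpha>_closed h_\<alpha>)
  show "(x, y) \<in> layer_order \<longleftrightarrow> (\<beta> y, \<beta> x) \<in> layer_order" if "x \<in> X" "y \<in> X" for x y
    using that by (simp add: rel_\<beta> flip: rel_one)
  show "\<beta> (\<beta> x) = x" if "x \<in> X" for x using that by (rule \<beta>_\<beta>)
  show "BNF_Def.Gr X \<alpha> \<subseteq> X \<times> X" "BNF_Def.Gr X \<beta> \<subseteq> X \<times> X"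
    by (auto simp: BNF_Def.Gr_def \<alpha>_closed \<beta>_closed)
  show "BNF_Def.Gr X \<beta> = BNF_Def.Gr X \<alpha> O BNF_Def.Gr X \<beta> O BNF_Def.Gr X \<alpha>"
    by (auto simp: BNF_Def.Gr_def \<alpha>_closed \<beta>_closed \<alpha>_\<alpha> \<alpha>_\<beta>_commute relcomp_unfold)
qed

lemma rel_tilde:
  assumes "j \<in> S"
  shows "rel (- j) = (X \<times> X - rel j)\<inverse> O BNF_Def.Gr X \<alpha>"
proof -
  have "(x, y) \<in> (X \<times> X - rel j)\<inverse> O BNF_Def.Gr X \<alpha> \<longleftrightarrow>
      x \<in> X \<and> y \<in> X \<and> (\<alpha> y, x) \<notin> rel j" for x y
    using \<alpha>_closed \<alpha>_\<alpha> unfolding BNF_Def.Gr_def relcomp_unfold by force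
  then show ?thesis
    unfolding rel_uminus[OF assms] set_eq_iff split_paired_All by (simp cong: conj_cong)
qed

lemma rel_minus:
  assumes "j \<in> S"
  shows "rel (- j) = BNF_Def.Gr X \<alpha> O (X \<times> X - rel j)\<inverse>"
proof -
  have "(\<alpha> y, x) \<in> rel j \<longleftrightarrow> (y, \<alpha> x) \<in> rel j" if "x \<in> X" "y \<in> X" for x y
    using that \<alpha>_\<alpha> by (auto simp: rel_iff h_\<alpha> \<alpha>_closed)
  moreover have "(x, y) \<in> BNF_Def.Gr X \<alpha> O (X \<times> X - rel j)\<inverse> \<longleftrightarrow>
      x \<in> X \<and> y \<in> X \<and> (y, \<alpha> x) \<notin> rel j" for x y
    using \<alpha>_closed unfolding BNF_Def.Gr_def relcomp_unfold by force
  ultimately show ?thesis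
    unfolding rel_uminus[OF assms] set_eq_iff split_paired_All by (simp cong: conj_cong)
qed

text \<open>Conjugation by \<open>\<beta>\<close> has the effect of taking converses, so \<open>\<not>\<close> agrees with \<open>-\<close>
  on the chain.\<close>
lemma rel_neg:
  assumes "j \<in> S"
  shows "rel (- j) =
    BNF_Def.Gr X \<alpha> O BNF_Def.Gr X \<beta> O (X \<times> X - rel j) O BNF_Def.Gr X \<beta>"
    (is "_ = ?N")
proof -
  have "(x, y) \<in> BNF_Def.Gr X \<alpha> O (X \<times> X - rel j)\<inverse> \<longleftrightarrow>
      x \<in> X \<and> y \<in> X \<and> (y, \<alpha> x) \<notin> rel j" for x y
    using \<alpha>_closed unfolding BNF_Def.Gr_def relcomp_unfold by force
  moreover have "(x, y) \<in> ?N \<longleftrightarrow> x \<in> X \<and> y \<in> X \<and> (\<beta> (\<alpha> x), \<beta> y) \<notin> rel j" for x y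
    using \<alpha>_closed \<beta>_closed \<beta>_\<beta> unfolding BNF_Def.Gr_def relcomp_unfold by force
  moreover have "(\<beta> (\<alpha> x), \<beta> y) \<in> rel j \<longleftrightarrow> (y, \<alpha> x) \<in> rel j"
    if "x \<in> X" "y \<in> X" for x y
    using that by (simp add: rel_\<beta> \<alpha>_closed)
  ultimately show ?thesis
    unfolding rel_minus[OF assms] set_eq_iff split_paired_All by (simp cong: conj_cong)
qed

lemma represented_over_sugihara_chain:
  "represented_over (sugihara_chain n) X layer_order (X \<times> X) \<alpha> \<beta>"
proof -
  let ?A = "sugihara_chain n" and ?B = "Dq X layer_order (X \<times> X) \<alpha> \<beta>"
  interpret DqRA ?A by (rule DqRA_sugihara_chain) (rule n_ge_2)
  have op: "a \<curlywedge>\<^bsub>?A\<^esub> b = min a b" "a \<curlyvee>\<^bsub>?A\<^esub> b = max a b" "\<sim>\<^bsub>?A\<^esub> a = - a"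
    "\<ominus>\<^bsub>?A\<^esub> a = - a" "\<sharp>\<^bsub>?A\<^esub> a = - a" for a b
    by (simp_all add: sugihara_chain_simps)
  have zero: "\<zero>\<^bsub>?A\<^esub> = - \<one>\<^bsub>?A\<^esub>" by (simp add: sugihara_chain_simps)
  have hom: "rel \<one>\<^bsub>?A\<^esub> = \<one>\<^bsub>?B\<^esub>" "rel \<zero>\<^bsub>?A\<^esub> = \<zero>\<^bsub>?B\<^esub>"
    "\<And>a b. \<lbrakk>a \<in> S; b \<in> S\<rbrakk> \<Longrightarrow> rel (a \<curlywedge>\<^bsub>?A\<^esub> b) = rel a \<curlywedge>\<^bsub>?B\<^esub> rel b"
    "\<And>a b. \<lbrakk>a \<in> S; b \<in> S\<rbrakk> \<Longrightarrow> rel (a \<curlyvee>\<^bsub>?A\<^esub> b) = rel a \<curlyvee>\<^bsub>?B\<^esub> rel b"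
    "\<And>a b. \<lbrakk>a \<in> S; b \<in> S\<rbrakk> \<Longrightarrow> rel (a \<otimes>\<^bsub>?A\<^esub> b) = rel a \<otimes>\<^bsub>?B\<^esub> rel b"
    "\<And>a. a \<in> S \<Longrightarrow> rel (\<sim>\<^bsub>?A\<^esub> a) = \<sim>\<^bsub>?B\<^esub> (rel a)"
    "\<And>a. a \<in> S \<Longrightarrow> rel (\<ominus>\<^bsub>?A\<^esub> a) = \<ominus>\<^bsub>?B\<^esub> (rel a)"
    "\<And>a. a \<in> S \<Longrightarrow> rel (\<sharp>\<^bsub>?A\<^esub> a) = \<sharp>\<^bsub>?B\<^esub> (rel a)"
    using rel_minus[OF one_in_S]
    by (simp_all add: op zero Dq_def Let_def rel_one rel_min rel_max rel_mult
        flip: rel_tilde rel_minus rel_neg)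
  have zero_closed: "\<zero>\<^bsub>?A\<^esub> \<in> S"
    unfolding zero_tilde by (intro tilde_closed one_closed)
  have "carrier ?B = upsets layer_order (X \<times> X)" by (simp add: Dq_def Let_def)
  then have "dq_subuniverse (rel ` S) ?B"
    using rel_upset zero_closed
    unfolding dq_subuniverse_def
    by (auto simp flip: hom intro!: imageI m_closed meet_closed join_closed tilde_closed
        minus_closed neg_closed)
  moreover have "rel \<in> dq_iso ?A (?B\<lparr>carrier := rel ` S\<rparr>)"
    using rel_inj hom by (auto simp: dq_iso_def iso_def hom_def bij_betw_def)
  ultimately show ?thesis
    unfolding represented_over_def using dq_frame by blast
qed

end

section \<open>A finite layered set of natural numbers\<close>

theorem theorem5p1:
  fixes n :: nat
  assumes "n \<ge> 2"
  shows "finitely_representable (sugihara_chain n)"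
proof -
  define k where "k = n div 2 - 1"
  have k: "n div 2 = Suc k" using assms by (simp add: k_def)
  \<comment> \<open>The points \<open>2 * m\<close> and \<open>2 * m + 1\<close> form layer \<open>m - k\<close>, so layer \<open>0\<close> is
    \<open>{2 * k, 2 * k + 1}\<close>, from which the second point is dropped when \<open>n\<close> is even.  With
    \<open>k = n div 2 - 1\<close> the layers are those from \<open>- k\<close> to \<open>k\<close>.\<close>
  \<comment> \<open>\<open>e\<close> hides the evenness of \<open>n\<close> from the arithmetic procedures.\<close>
  define e where "e \<longleftrightarrow> even n"
  define X where "X = {p. p div 2 \<le> 2 * k \<and> (e \<longrightarrow> p \<noteq> Suc (2 * k))}"
  define h where "h p = int (p div 2) - int k" for p :: nat
  define \<alpha> where "\<alpha> p = (if e \<and> p = 2 * k then p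
    else if even p then p + 1 else p - 1)" for p :: nat
  define \<beta> where "\<beta> p = 2 * (2 * k - p div 2) + p mod 2" for p :: nat
  have parity: "\<exists>m. x = 2 * m \<or> x = Suc (2 * m)" for x :: nat
    by presburger
  note parity_neq = Suc_double_not_eq_double double_not_eq_Suc_double
  interpret layered_set n X h \<alpha> \<beta>
  proof
    show "2 \<le> n" by (rule assms)
  next
    fix x assume x: "x \<in> X"
    obtain m where m: "x = 2 * m \<or> x = Suc (2 * m)" using parity by blast
    show "\<alpha> x \<in> X" using x m by (auto simp: parity_neq X_def \<alpha>_def)
    show "\<beta> x \<in> X" using x m by (auto simp: parity_neq X_def \<beta>_def)
    show "\<alpha> (\<alpha> x) = x" using x m by (auto simp: parity_neq X_def \<alpha>_def)
    show "\<beta> (\<beta> x) = x" using x m by (auto simp: parity_neq X_def \<beta>_def)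
    show "\<alpha> (\<beta> x) = \<beta> (\<alpha> x)" using x m by (auto simp: parity_neq X_def \<alpha>_def \<beta>_def)
    show "h (\<alpha> x) = h x" using x m by (auto simp: parity_neq X_def \<alpha>_def h_def)
    show "h (\<beta> x) = - h x" using x m by (auto simp: parity_neq X_def \<beta>_def h_def)
    show "\<alpha> x = x \<longleftrightarrow> even n \<and> h x = 0"
      using x m by (auto simp: parity_neq X_def \<alpha>_def h_def simp flip: e_def)
  next
    fix x y assume xy: "x \<in> X" "y \<in> X" "h x = h y"
    obtain m m' where m: "x = 2 * m \<or> x = Suc (2 * m)" "y = 2 * m' \<or> y = Suc (2 * m')"
      using parity by metis
    show "y = x \<or> y = \<alpha> x" using xy m by (auto simp: parity_neq X_def \<alpha>_def h_def)
  next
    show "h ` X = {l. \<bar>l\<bar> < int (n div 2)}"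
    proof (intro equalityI subsetI)
      fix l assume "l \<in> h ` X"
      then show "l \<in> {l. \<bar>l\<bar> < int (n div 2)}"
        by (auto simp: X_def h_def k)
    next
      fix l assume l: "l \<in> {l. \<bar>l\<bar> < int (n div 2)}"
      let ?p = "2 * nat (l + int k)"
      have "?p \<in> X" using l by (auto simp: parity_neq X_def k)
      moreover have "h ?p = l" using l by (auto simp: h_def k)
      ultimately show "l \<in> h ` X" by force
    qed
  qed
  have "X \<subseteq> {..<4 * k + 2}" by (auto simp: X_def)
  then have "finite X" by (rule finite_subset) simp
  with represented_over_sugihara_chain DqRA_sugihara_chain[OF assms] show ?thesis
    unfolding finitely_representable_def by blast
qed

end
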